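(* Let $k\ge2$ be an integer and let $H$ be a finite graph that admits a proper $k$-coloring (in particular $H$ has no loops). Then $\hom(\mathbb{T}^{k-1},H)$ has long range action.
   Context: A proper $k$-coloring of $H$ is a map from its nodes to a $k$-element set assigning distinct colors to adjacent nodes. $\mathbb{T}^r$ is the infinite connected cycle-free graph with all degrees $r+1$, with a fixed root site $x$; $\hom(\mathbb{T}^r,H)$ is the set of graph homomorphisms $\mathbb{T}^r\to H$. $\hom(\mathbb{T}^r,H)$ has long range action if there exist $\varphi\in\hom(\mathbb{T}^r,H)$ and a node $i$ of $H$ such that for every $n\ge1$, no $\psi\in\hom(\mathbb{T}^r,H)$ which agrees with $\varphi$ on all sites at distance $n$ from $x$ satisfies $\psi(x)=i$.
   Formalization: The graph H is additionally assumed to have at least one edge; for an edgeless H there are no homomorphisms from the tree to H, so long range action fails and the claim as stated is false. *)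

theory Defs
  imports Main
begin

definition finite_graph :: "'a set \<Rightarrow> ('a \<Rightarrow> 'a \<Rightarrow> bool) \<Rightarrow> bool" where
  "finite_graph V E \<longleftrightarrow> finite V \<and> (\<forall>u v. E u v \<longrightarrow> u \<in> V \<and> v \<in> V) \<and> (\<forall>u v. E u v \<longrightarrow> E v u)"

definition proper_coloring :: "'a set \<Rightarrow> ('a \<Rightarrow> 'a \<Rightarrow> bool) \<Rightarrow> nat \<Rightarrow> ('a \<Rightarrow> nat) \<Rightarrow> bool" where
  "proper_coloring V E k c \<longleftrightarrow> (\<forall>v\<in>V. c v < k) \<and> (\<forall>u v. E u v \<longrightarrow> c u \<noteq> c v)"

text \<open>The (r+1)-regular tree T^r: sites are reduced words over {0..r} (no two consecutive
  letters equal), i.e. the Cayley graph of the free product of r+1 copies of Z/2.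
  The root x is the empty word; the distance of a site from the root is its length.\<close>
definition tree_sites :: "nat \<Rightarrow> nat list set" where
  "tree_sites r = {w. set w \<subseteq> {..r} \<and> distinct_adj w}"

definition tree_adj :: "nat \<Rightarrow> nat list \<Rightarrow> nat list \<Rightarrow> bool" where
  "tree_adj r w w' \<longleftrightarrow> w \<in> tree_sites r \<and> w' \<in> tree_sites r \<and>
     ((\<exists>a. w' = w @ [a]) \<or> (\<exists>a. w = w' @ [a]))"

definition tree_root :: "nat list" where "tree_root = []"

definition tree_hom :: "nat \<Rightarrow> 'a set \<Rightarrow> ('a \<Rightarrow> 'a \<Rightarrow> bool) \<Rightarrow> (nat list \<Rightarrow> 'a) set" where
  "tree_hom r V E = {\<phi>. (\<forall>w\<in>tree_sites r. \<phi> w \<in> V) \<and>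
      (\<forall>w w'. tree_adj r w w' \<longrightarrow> E (\<phi> w) (\<phi> w'))}"

definition long_range_action :: "nat \<Rightarrow> 'a set \<Rightarrow> ('a \<Rightarrow> 'a \<Rightarrow> bool) \<Rightarrow> bool" where
  "long_range_action r V E \<longleftrightarrow>
     (\<exists>\<phi>\<in>tree_hom r V E. \<exists>i\<in>V. \<forall>n\<ge>1.
        \<not> (\<exists>\<psi>\<in>tree_hom r V E.
              (\<forall>w\<in>tree_sites r. length w = n \<longrightarrow> \<psi> w = \<phi> w) \<and> \<psi> tree_root = i))"

end

theory Submission
  imports Defs "HOL-Analysis.Function_Topology"
begin

text \<open>Place the nodes of \<open>H\<close> on the unit sphere of \<open>\<real>\<^sup>k\<^sup>-\<^sup>1\<close> by a map \<open>f\<close> so that the largest inner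
  product \<open>m\<close> along an edge is minimal and, subject to that, the number of tight edges (those with
  inner product \<open>m\<close>) is minimal. A proper \<open>k\<close>-colouring, sent to the vertices of a simplex, shows
  \<open>m < 0\<close>. If \<open>- f u\<close> were outside the cone spanned by the tight neighbours of \<open>u\<close>, moving \<open>f u\<close>
  away from a separating direction would loosen all tight edges at \<open>u\<close>; so, by Caratheodory,
  \<open>- f u = (\<Sum>v\<in>A. l v * f v)\<close> with \<open>l \<ge> 0\<close> for some set \<open>A\<close> of at most \<open>k - 1\<close> tight neighbours.
  Let \<open>\<phi>\<close> assign to the \<open>k - 1\<close> children of a site mapped to \<open>u\<close> all members of \<open>A\<close>.
  If \<open>f (\<psi> w) \<noteq> f (\<phi> w)\<close>, pairing with \<open>f (\<psi> w)\<close> gives \<open>f v \<bullet> f (\<psi> w) > m\<close> for some \<open>v \<in> A\<close>; as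
  neighbours of \<open>\<psi> w\<close> have inner product at most \<open>m\<close> with it, the images under \<open>f\<close> still differ
  at the child sent to \<open>v\<close>. So the disagreement at the root reaches every level.\<close>

section \<open>Inner products on the first \<open>d\<close> coordinates\<close>

definition ip :: "nat \<Rightarrow> (nat \<Rightarrow> real) \<Rightarrow> (nat \<Rightarrow> real) \<Rightarrow> real" where
  "ip d x y = (\<Sum>j<d. x j * y j)"

lemma ip_commute: "ip d x y = ip d y x"
  by (simp add: ip_def mult.commute)

lemma ip_add_left: "ip d (\<lambda>j. x j + y j) z = ip d x z + ip d y z"
  by (simp add: ip_def algebra_simps sum.distrib)

lemma ip_diff_left: "ip d (\<lambda>j. x j - y j) z = ip d x z - ip d y z"
  by (simp add: ip_def algebra_simps sum_subtractf)

lemma ip_scale_left: "ip d (\<lambda>j. c * x j) z = c * ip d x z"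
  by (simp add: ip_def sum_distrib_left mult.assoc)

lemma ip_add_right: "ip d z (\<lambda>j. x j + y j) = ip d z x + ip d z y"
  by (simp add: ip_commute[of d z] ip_add_left)

lemma ip_diff_right: "ip d z (\<lambda>j. x j - y j) = ip d z x - ip d z y"
  by (simp add: ip_commute[of d z] ip_diff_left)

lemma ip_scale_right: "ip d z (\<lambda>j. c * x j) = c * ip d z x"
  by (simp add: ip_commute[of d z] ip_scale_left)

lemma ip_sum_left: "ip d (\<lambda>j. \<Sum>i\<in>I. l i * a i j) z = (\<Sum>i\<in>I. l i * ip d (a i) z)"
  unfolding ip_def sum_distrib_left sum_distrib_right mult.assoc by (rule sum.swap)

lemma ip_cong: "(\<And>j. j < d \<Longrightarrow> x j = x' j) \<Longrightarrow> (\<And>j. j < d \<Longrightarrow> y j = y' j) \<Longrightarrow> ip d x y = ip d x' y'"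
  by (simp add: ip_def)

lemma ip_self_nonneg: "ip d x x \<ge> 0"
  by (simp add: ip_def sum_nonneg)

lemma ip_self_eq_0: "ip d x x = 0 \<longleftrightarrow> (\<forall>j<d. x j = 0)"
  unfolding ip_def by (subst sum_nonneg_eq_0_iff) auto

lemma ip_unit_diff:
  assumes "ip d x x = 1" "ip d y y = 1"
  shows "ip d (\<lambda>j. x j - y j) (\<lambda>j. x j - y j) = 2 - 2 * ip d x y"
  using assms by (simp add: ip_diff_left ip_diff_right ip_commute[of d y x])

lemma ip_unit_le_1:
  assumes "ip d x x = 1" "ip d y y = 1"
  shows "ip d x y \<le> 1"
  using ip_unit_diff[OF assms] ip_self_nonneg[of d "\<lambda>j. x j - y j"] by simp

lemma ip_unit_eq_1D:
  assumes "ip d x x = 1" "ip d y y = 1" "ip d x y = 1" "j < d"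
  shows "x j = y j"
proof -
  have "ip d (\<lambda>j. x j - y j) (\<lambda>j. x j - y j) = 0"
    using ip_unit_diff[OF assms(1,2)] assms(3) by simp
  then show ?thesis using assms(4) by (simp add: ip_self_eq_0)
qed

section \<open>Convex cones: Farkas and Caratheodory\<close>

text \<open>Bartl's induction: if the last generator is needed, a vector violating the reduced
  hypothesis is used to project all other vectors onto the kernel of that generator.\<close>
lemma farkas:
  fixes a :: "'i \<Rightarrow> nat \<Rightarrow> real"
  assumes "finite I" and "\<And>x. (\<forall>i\<in>I. ip d (a i) x \<ge> 0) \<Longrightarrow> ip d b x \<ge> 0"
  shows "\<exists>l. (\<forall>i\<in>I. l i \<ge> 0) \<and> (\<forall>j<d. b j = (\<Sum>i\<in>I. l i * a i j))"
  using assms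
proof (induction I arbitrary: a b rule: finite_induct)
  case empty
  have "b j = 0" if "j < d" for j
  proof -
    have "ip d b (\<lambda>j. - 1 * b j) \<ge> 0" using empty by blast
    then have "ip d b b = 0"
      using ip_self_nonneg[of d b] unfolding ip_scale_right by simp
    then show ?thesis using that by (simp add: ip_self_eq_0)
  qed
  then show ?case by simp
next
  case (insert p I)
  show ?case
  proof (cases "\<forall>x. (\<forall>i\<in>I. ip d (a i) x \<ge> 0) \<longrightarrow> ip d b x \<ge> 0")
    case True
    then obtain l where l: "\<forall>i\<in>I. l i \<ge> 0" "\<forall>j<d. b j = (\<Sum>i\<in>I. l i * a i j)"
      using insert.IH[of a b] by blast
    have "(\<Sum>i\<in>I. (l(p := 0)) i * a i j) = (\<Sum>i\<in>I. l i * a i j)" for j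
      using insert.hyps by (intro sum.cong) auto
    then show ?thesis
      using l insert.hyps by (intro exI[of _ "l(p := 0)"]) auto
  next
    case False
    then obtain x1 where x1: "\<forall>i\<in>I. ip d (a i) x1 \<ge> 0" "ip d b x1 < 0"
      by (meson not_le)
    have p1: "ip d (a p) x1 < 0"
      using insert.prems[of x1] x1 by force
    define x0 where "x0 = (\<lambda>j. (1 / - ip d (a p) x1) * x1 j)"
    have x0: "\<forall>i\<in>I. ip d (a i) x0 \<ge> 0" "ip d b x0 < 0" "ip d (a p) x0 = -1"
      unfolding x0_def ip_scale_right using x1 p1 
      by (auto simp: field_simps divide_neg_neg divide_nonneg_neg mult_less_0_iff)
    \<comment> \<open>The adjoint of the projection along \<open>x0\<close> onto the kernel of
      \<open>a p\<close>: pairing \<open>a'\<close> and \<open>b'\<close> with \<open>x\<close> is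
      pairing \<open>a\<close> and \<open>b\<close> with the projection of \<open>x\<close>.\<close>
    define a' where "a' = (\<lambda>i j. a i j + ip d (a i) x0 * a p j)"
    define b' where "b' = (\<lambda>j. b j + ip d b x0 * a p j)"
    have "ip d b' x \<ge> 0" if "\<forall>i\<in>I. ip d (a' i) x \<ge> 0" for x
    proof -
      define y where "y = (\<lambda>j. x j + ip d (a p) x * x0 j)"
      have "ip d (a i) y = ip d (a' i) x" for i
        by (simp add: y_def a'_def ip_add_right ip_add_left ip_scale_right ip_scale_left)
      moreover have "ip d b y = ip d b' x"
        by (simp add: y_def b'_def ip_add_right ip_add_left ip_scale_right ip_scale_left)
      moreover have "ip d (a p) y = 0"
        by (simp add: y_def ip_add_right ip_scale_right x0)
      ultimately show ?thesis using insert.prems[of y] that by simp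
    qed
    then obtain l where l: "\<forall>i\<in>I. l i \<ge> 0" "\<forall>j<d. b' j = (\<Sum>i\<in>I. l i * a' i j)"
      using insert.IH[of a' b'] by blast
    \<comment> \<open>Unfolding \<open>a'\<close> and \<open>b'\<close> leaves this multiple of
      \<open>a p\<close>; \<open>x0\<close> pairs nonnegatively with each \<open>a i\<close> and
      negatively with \<open>b\<close>, hence \<open>s \<ge> 0\<close>.\<close>
    define s where "s = (\<Sum>i\<in>I. l i * ip d (a i) x0) - ip d b x0"
    have "s \<ge> 0" unfolding s_def using x0 l by (smt (verit) mult_nonneg_nonneg sum_nonneg)
    moreover have "b j = (\<Sum>i\<in>insert p I. (l(p := s)) i * a i j)" if "j < d" for j
    proof -
      have "(\<Sum>i\<in>insert p I. (l(p := s)) i * a i j) = s * a p j + (\<Sum>i\<in>I. (l(p := s)) i * a i j)"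
        using insert.hyps by simp
      also have "(\<Sum>i\<in>I. (l(p := s)) i * a i j) = (\<Sum>i\<in>I. l i * a i j)"
        using insert.hyps by (intro sum.cong) auto
      also have "s * a p j + \<dots> = (\<Sum>i\<in>I. l i * a' i j) - ip d b x0 * a p j"
        by (simp add: s_def a'_def algebra_simps sum.distrib sum_distrib_left)
      also have "\<dots> = b j" using l(2) that by (simp add: b'_def flip: l(2)[rule_format])
      finally show ?thesis by simp
    qed
    ultimately show ?thesis
      using l(1) by (intro exI[of _ "l(p := s)"]) auto
  qed
qed

text \<open>Gaussian elimination: a vector \<open>a p\<close> with nonzero last coordinate clears
  that coordinate in the others, and a dependence among the cleared vectors lifts by giving
  \<open>p\<close> a suitable coefficient.\<close>

lemma linear_dependence:
  fixes a :: "'i \<Rightarrow> nat \<Rightarrow> real"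
  assumes "finite I" "d < card I"
  shows "\<exists>\<mu>. (\<exists>i\<in>I. \<mu> i \<noteq> 0) \<and> (\<forall>j<d. (\<Sum>i\<in>I. \<mu> i * a i j) = 0)"
  using assms
proof (induction d arbitrary: I a)
  case 0
  then show ?case by (intro exI[of _ "\<lambda>_. 1"]) (auto simp: card_gt_0_iff)
next
  case (Suc d)
  show ?case
  proof (cases "\<forall>i\<in>I. a i d = 0")
    case True
    obtain \<mu> where "\<exists>i\<in>I. \<mu> i \<noteq> 0" "\<forall>j<d. (\<Sum>i\<in>I. \<mu> i * a i j) = 0"
      using Suc.IH[of I a] Suc.prems by auto
    then show ?thesis using True by (intro exI[of _ \<mu>]) (auto simp: less_Suc_eq)
  next
    case False
    then obtain p where p: "p \<in> I" "a p d \<noteq> 0" by blast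
    define a' where "a' = (\<lambda>i j. a i j - a i d / a p d * a p j)"
    obtain \<mu> where \<mu>: "\<exists>i\<in>I - {p}. \<mu> i \<noteq> 0" "\<forall>j<d. (\<Sum>i\<in>I - {p}. \<mu> i * a' i j) = 0"
      using Suc.IH[of "I - {p}" a'] Suc.prems p by (auto simp: less_diff_conv)
    define s where "s = - (\<Sum>i\<in>I - {p}. \<mu> i * (a i d / a p d))"
    have "(\<Sum>i\<in>I. (\<mu>(p := s)) i * a i j) = 0" if "j < Suc d" for j
    proof -
      have "(\<Sum>i\<in>I. (\<mu>(p := s)) i * a i j) = s * a p j + (\<Sum>i\<in>I - {p}. (\<mu>(p := s)) i * a i j)"
        using p Suc.prems by (subst sum.remove[of _ p]) auto
      also have "(\<Sum>i\<in>I - {p}. (\<mu>(p := s)) i * a i j) = (\<Sum>i\<in>I - {p}. \<mu> i * a i j)"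
        by (intro sum.cong) auto
      also have "s * a p j + \<dots> = (\<Sum>i\<in>I - {p}. \<mu> i * a' i j)"
        by (simp add: s_def a'_def algebra_simps sum_subtractf sum_distrib_left)
      also have "\<dots> = 0"
        using \<mu>(2) that p by (cases "j = d") (auto simp: a'_def)
      finally show ?thesis .
    qed
    then show ?thesis using \<mu>(1) by (intro exI[of _ "\<mu>(p := s)"]) auto
  qed
qed

text \<open>More than \<open>d\<close> generators are linearly dependent; subtracting a multiple of
  a dependence keeps the sum and can be stopped when a first coefficient vanishes, which drops a
  generator.\<close>

lemma cone_caratheodory:
  fixes a :: "'i \<Rightarrow> nat \<Rightarrow> real"
  assumes "finite I" "\<forall>i\<in>I. l i \<ge> 0" "\<forall>j<d. b j = (\<Sum>i\<in>I. l i * a i j)"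
  shows "\<exists>A l'. A \<subseteq> I \<and> card A \<le> d \<and> (\<forall>i\<in>A. l' i \<ge> 0) \<and> (\<forall>j<d. b j = (\<Sum>i\<in>A. l' i * a i j))"
  using assms
proof (induction "card I" arbitrary: I l rule: less_induct)
  case less
  show ?case
  proof (cases "card I \<le> d")
    case True
    then show ?thesis using less.prems by blast
  next
    case False
    then obtain \<mu>0 where \<mu>0: "\<exists>i\<in>I. \<mu>0 i \<noteq> 0" "\<forall>j<d. (\<Sum>i\<in>I. \<mu>0 i * a i j) = 0"
      using linear_dependence[of I d a] less.prems by auto
    obtain \<mu> where \<mu>: "\<exists>i\<in>I. \<mu> i > 0" "\<forall>j<d. (\<Sum>i\<in>I. \<mu> i * a i j) = 0"
    proof (cases "\<exists>i\<in>I. \<mu>0 i > 0")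
      case True
      then show ?thesis using \<mu>0 that by blast
    next
      case False
      then show ?thesis using \<mu>0 that[of "\<lambda>i. - \<mu>0 i"]
        by (auto simp: sum_negf) (metis less_linear)
    qed
    define Q where "Q = {i\<in>I. \<mu> i > 0}"
    have Q: "finite Q" "Q \<noteq> {}" using \<mu> less.prems by (auto simp: Q_def)
    \<comment> \<open>Ratio test: the minimal ratio is the largest multiple of \<open>\<mu>\<close>
      that keeps all coefficients nonnegative; it annihilates the one at \<open>p\<close>. Indices
      with \<open>\<mu> i \<le> 0\<close> impose no bound.\<close>
    define p where "p = arg_min_on (\<lambda>i. l i / \<mu> i) Q"
    have p: "p \<in> Q" and pmin: "\<And>i. i \<in> Q \<Longrightarrow> l p / \<mu> p \<le> l i / \<mu> i"
      using arg_min_if_finite(1)[OF Q] arg_min_least[OF Q] by (auto simp: p_def)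
    define t where "t = l p / \<mu> p"
    define l' where "l' = (\<lambda>i. l i - t * \<mu> i)"
    have pI: "p \<in> I" "\<mu> p > 0" using p by (auto simp: Q_def)
    have t0: "t \<ge> 0" using pI less.prems by (simp add: t_def)
    have "l' i \<ge> 0" if "i \<in> I" for i
    proof (cases "\<mu> i > 0")
      case True
      then show ?thesis using pmin[of i] that by (auto simp: l'_def Q_def t_def field_simps)
    next
      case False
      then have "t * \<mu> i \<le> 0" using t0 by (simp add: mult_nonneg_nonpos)
      then show ?thesis using less.prems(2) that by (auto simp: l'_def)
    qed
    moreover have "b j = (\<Sum>i\<in>I - {p}. l' i * a i j)" if "j < d" for j
    proof -
      have "(\<Sum>i\<in>I. l' i * a i j) = (\<Sum>i\<in>I. l i * a i j) - t * (\<Sum>i\<in>I. \<mu> i * a i j)"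
        by (simp add: l'_def algebra_simps sum_subtractf sum_distrib_left)
      moreover have "l' p = 0" using pI by (simp add: l'_def t_def)
      ultimately show ?thesis
        using \<mu>(2) that less.prems pI by (simp add: sum.remove[of I p])
    qed
    moreover have "card (I - {p}) < card I"
      using pI less.prems by (meson card_Diff1_less)
    ultimately obtain A l'' where "A \<subseteq> I - {p}" "card A \<le> d" "\<forall>i\<in>A. l'' i \<ge> 0"
      "\<forall>j<d. b j = (\<Sum>i\<in>A. l'' i * a i j)"
      using less.hyps[of "I - {p}" l'] less.prems(1) by auto
    then show ?thesis by blast
  qed
qed

section \<open>Optimal placements on the sphere and their perturbation\<close>

text \<open>Coordinates from \<open>d\<close> on and values outside \<open>V\<close> stay free; they
  must be cut off before compactness applies.\<close>

definition unit_on :: "'a set \<Rightarrow> nat \<Rightarrow> ('a \<Rightarrow> nat \<Rightarrow> real) \<Rightarrow> bool" where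
  "unit_on V d f \<longleftrightarrow> (\<forall>v\<in>V. ip d (f v) (f v) = 1)"

text \<open>Tychonoff's theorem; it is applied once over coordinates and once over nodes.\<close>

lemma compact_funcset:
  assumes "compact C"
  shows "compact {f :: 'i \<Rightarrow> 'b::topological_space. \<forall>v. f v \<in> C}"
proof -
  have "compactin (product_topology (\<lambda>_. euclidean) UNIV) (PiE (UNIV :: 'i set) (\<lambda>_. C))"
    using assms by (simp add: compactin_PiE)
  moreover have "PiE (UNIV :: 'i set) (\<lambda>_. C) = {f. \<forall>v. f v \<in> C}" by auto
  ultimately show ?thesis by (simp add: euclidean_product_topology)
qed

lemma continuous_on_coord2:
  "continuous_on S (\<lambda>f :: 'a \<Rightarrow> nat \<Rightarrow> real. f v j)"
  using continuous_on_product_then_coordinatewise[OF continuous_on_product_coordinates]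
  by (rule continuous_on_subset) auto

lemma continuous_on_ip:
  "continuous_on S (\<lambda>f :: 'a \<Rightarrow> nat \<Rightarrow> real. ip d (f u) (f v))"
  unfolding ip_def by (intro continuous_intros continuous_on_coord2)

lemma continuous_on_Max_image:
  fixes h :: "'e \<Rightarrow> 'x::topological_space \<Rightarrow> real"
  assumes "finite I" "I \<noteq> {}" "\<And>i. i \<in> I \<Longrightarrow> continuous_on S (h i)"
  shows "continuous_on S (\<lambda>x. Max ((\<lambda>i. h i x) ` I))"
  using assms
proof (induction I rule: finite_ne_induct)
  case (singleton x)
  then show ?case by simp
next
  case (insert p I)
  then have "continuous_on S (\<lambda>x. max (h p x) (Max ((\<lambda>i. h i x) ` I)))"
    by (intro continuous_on_max) auto
  then show ?case using insert.hyps by simp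
qed

lemma optimal_vector_coloring:
  fixes f0 :: "'a \<Rightarrow> nat \<Rightarrow> real" and D :: "('a \<times> 'a) set"
  assumes D: "finite D" "D \<noteq> {}" "D \<subseteq> V \<times> V" and f0: "unit_on V d f0"
  obtains f m where "unit_on V d f" "\<And>u v. (u, v) \<in> D \<Longrightarrow> ip d (f u) (f v) \<le> m"
    "\<And>g. unit_on V d g \<Longrightarrow> \<exists>(u, v) \<in> D. ip d (g u) (g v) \<ge> m"
proof -
  define K where "K = {f :: 'a \<Rightarrow> nat \<Rightarrow> real. \<forall>v. f v \<in> {x. \<forall>j. x j \<in> {-1..1}}}
    \<inter> (\<Inter>v\<in>V. {f. ip d (f v) (f v) = 1})"
  define M where "M = (\<lambda>f :: 'a \<Rightarrow> nat \<Rightarrow> real. Max ((\<lambda>e. ip d (f (fst e)) (f (snd e))) ` D))"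
  have "compact K" unfolding K_def
    by (intro compact_Int_closed compact_funcset closed_INT ballI closed_Collect_eq
        continuous_on_ip continuous_on_const) simp
  \<comment> \<open>Brings any competitor into the compact box without changing inner products
    between nodes of \<open>V\<close>.\<close>
  define cut where "cut = (\<lambda>(g :: 'a \<Rightarrow> nat \<Rightarrow> real) v j. if v \<in> V \<and> j < d then g v j else 0)"
  have ip_cut: "ip d (cut g u) (cut g v) = ip d (g u) (g v)" if "u \<in> V" "v \<in> V" for g u v
    using that by (intro ip_cong) (auto simp: cut_def)
  have cutK: "cut g \<in> K" if "unit_on V d g" for g
  proof -
    have "cut g v j \<in> {-1..1}" for v j
    proof (cases "v \<in> V \<and> j < d")
      case True
      then have "g v j * g v j \<le> ip d (g v) (g v)"
        unfolding ip_def by (intro member_le_sum[of j "{..<d}" "\<lambda>j. g v j * g v j"]) auto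
      then have "(g v j)\<^sup>2 \<le> 1" using that True by (simp add: unit_on_def power2_eq_square)
      then show ?thesis using True by (simp add: cut_def abs_square_le_1 abs_le_iff)
    qed (auto simp: cut_def)
    then show ?thesis using that by (auto simp: K_def unit_on_def ip_cut)
  qed
  have "continuous_on K M"
    unfolding M_def using D by (intro continuous_on_Max_image continuous_on_ip)
  then obtain f where f: "f \<in> K" "\<And>g. g \<in> K \<Longrightarrow> M f \<le> M g"
    using continuous_attains_inf[OF \<open>compact K\<close>, of M] cutK[OF f0] by blast
  show thesis
  proof (rule that[of f "M f"])
    show "unit_on V d f" using f(1) by (auto simp: K_def unit_on_def)
    show "ip d (f u) (f v) \<le> M f" if "(u, v) \<in> D" for u v
      unfolding M_def using that D by (intro Max_ge) force+
    show "\<exists>(u, v) \<in> D. ip d (g u) (g v) \<ge> M f" if "unit_on V d g" for g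
    proof -
      have "M (cut g) \<in> (\<lambda>e. ip d (cut g (fst e)) (cut g (snd e))) ` D"
        unfolding M_def using D by (intro Max_in) auto
      then obtain e where "e \<in> D" "M (cut g) = ip d (cut g (fst e)) (cut g (snd e))" by blast
      then have "e \<in> D" "M (cut g) = ip d (g (fst e)) (g (snd e))"
        using D by (auto simp: ip_cut)
      then show ?thesis using f(2)[OF cutK[OF that]] by (auto intro!: bexI[of _ e])
    qed
  qed
qed

text \<open>Move \<open>y\<close> to \<open>y - e * x\<close> and renormalise. For small
  \<open>e > 0\<close> the norm drops below 1, and since \<open>m < 0\<close>, renormalising pushes
  a tight inner product strictly below \<open>m\<close> even if \<open>x\<close> is orthogonal to
  \<open>f v\<close>. The other inner products have room by continuity.\<close>

lemma unit_perturbation: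
  assumes "finite P" "ip d y y = 1" "m < 0" "ip d x y > 0"
    and le: "\<And>v. v \<in> P \<Longrightarrow> ip d y (f v) \<le> m"
    and tight: "\<And>v. v \<in> P \<Longrightarrow> ip d y (f v) = m \<Longrightarrow> ip d x (f v) \<ge> 0"
  shows "\<exists>y'. ip d y' y' = 1 \<and> (\<forall>v\<in>P. ip d y' (f v) < m)"
proof -
  define z where "z = (\<lambda>e j. y j - e * x j)"
  define N where "N = (\<lambda>e. ip d (z e) (z e))"
  have z_ip: "ip d (z e) (f v) = ip d y (f v) - e * ip d x (f v)" for e v
    by (simp add: z_def ip_diff_left ip_scale_left)
  have N: "N e = 1 + e * (e * ip d x x - 2 * ip d x y)" for e
    using assms(2) by (simp add: N_def z_def ip_diff_left ip_diff_right ip_scale_left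
        ip_scale_right ip_commute[of d y x] algebra_simps)
  have pos: "\<forall>\<^sub>F e in at_right (0::real). e > 0"
    by (rule eventually_at_right_less)
  have "((\<lambda>e. e * ip d x x - 2 * ip d x y) \<longlongrightarrow> 0 * ip d x x - 2 * ip d x y) (at_right 0)"
    by (intro tendsto_intros)
  then have "\<forall>\<^sub>F e in at_right 0. e * ip d x x - 2 * ip d x y < 0"
    using assms(4) by (intro order_tendstoD) auto
  then have N_lt: "\<forall>\<^sub>F e in at_right 0. N e < 1"
    using pos by eventually_elim (simp add: N mult_pos_neg)
  have lim: "(N \<longlongrightarrow> 1 + 0 * (0 * ip d x x - 2 * ip d x y)) (at_right 0)"
    unfolding N by (intro tendsto_intros)
  then have N_pos: "\<forall>\<^sub>F e in at_right 0. N e > 0"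
    by (intro order_tendstoD) auto
  \<comment> \<open>The factor \<open>sqrt (N e)\<close> anticipates the division of
    \<open>z e\<close> by its norm.\<close>
  have "\<forall>\<^sub>F e in at_right 0. ip d (z e) (f v) < m * sqrt (N e)" if v: "v \<in> P" for v
  proof (cases "ip d y (f v) = m")
    case True
    show ?thesis using N_lt pos
    proof eventually_elim
      case (elim e)
      have "sqrt (N e) < 1" using elim by simp
      then have "m * sqrt (N e) > m" using assms(3) by simp
      moreover have "e * ip d x (f v) \<ge> 0" using tight[OF v True] elim by simp
      ultimately show ?case by (simp add: z_ip True)
    qed
  next
    case False
    have "((\<lambda>e. ip d y (f v) - e * ip d x (f v) - m * sqrt (N e)) \<longlongrightarrow>
        ip d y (f v) - 0 * ip d x (f v) - m * sqrt (1 + 0 * (0 * ip d x x - 2 * ip d x y))) (at_right 0)"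
      by (intro tendsto_intros lim)
    then have "\<forall>\<^sub>F e in at_right 0. ip d y (f v) - e * ip d x (f v) - m * sqrt (N e) < 0"
      using False le[OF v] by (intro order_tendstoD) auto
    then show ?thesis by eventually_elim (simp add: z_ip)
  qed
  then have "\<forall>\<^sub>F e in at_right 0. \<forall>v\<in>P. ip d (z e) (f v) < m * sqrt (N e)"
    using assms(1) by (simp add: eventually_ball_finite)
  with N_pos have "\<forall>\<^sub>F e in at_right 0. N e > 0 \<and> (\<forall>v\<in>P. ip d (z e) (f v) < m * sqrt (N e))"
    by eventually_elim simp
  then obtain e where e: "N e > 0" "\<forall>v\<in>P. ip d (z e) (f v) < m * sqrt (N e)"
    using eventually_happens[of _ "at_right (0::real)"] by auto
  let ?y = "\<lambda>j. (1 / sqrt (N e)) * z e j"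
  have "ip d ?y ?y = 1"
    unfolding ip_scale_left ip_scale_right using e(1)
    by (simp add: N_def field_simps)
  moreover have "\<forall>v\<in>P. ip d ?y (f v) < m"
    unfolding ip_scale_left using e by (simp add: field_simps)
  ultimately show ?thesis by blast
qed

section \<open>A simplex with pairwise negative inner products\<close>

text \<open>Telescoping, by \<open>1 / (n + 1)\<^sup>2 \<le> 1 / n - 1 / (n + 1)\<close>.\<close>

lemma sum_inverse_squares_less:
  assumes "m \<ge> 1" "m \<le> d"
  shows "(\<Sum>j\<in>{m..<d}. (1 / (real j + 1))\<^sup>2) < 1 / real m"
proof -
  have "(\<Sum>j\<in>{m..<d}. (1 / (real j + 1))\<^sup>2) \<le> 1 / real m - 1 / real d"
    using assms(2,1)
  proof (induction rule: dec_induct)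
    case (step n)
    have "(1 / (real n + 1))\<^sup>2 \<le> 1 / real n - 1 / real (Suc n)"
      using step(1) step.prems by (simp add: divide_simps power2_eq_square) (simp add: algebra_simps)
    then show ?case using step by simp
  qed simp
  also have "\<dots> < 1 / real m" using assms by simp
  finally show ?thesis .
qed

lemma negative_simplex:
  assumes "d \<ge> 1"
  obtains w :: "nat \<Rightarrow> nat \<Rightarrow> real" where "\<And>i. i \<le> d \<Longrightarrow> ip d (w i) (w i) = 1"
    "\<And>i i'. i \<le> d \<Longrightarrow> i' \<le> d \<Longrightarrow> i \<noteq> i' \<Longrightarrow> ip d (w i) (w i') < 0"
proof -
  \<comment> \<open>Unnormalised Helmert contrasts: for each \<open>j < d\<close> the entries over
    \<open>i \<le> d\<close> sum to zero. For \<open>i < i'\<close> the term \<open>- 1 / i'\<close>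
    at \<open>j = i' - 1\<close> outweighs the later inverse squares.\<close>
  define u where "u = (\<lambda>i j. if i = Suc j then 1 else if i \<le> j then - (1 / (real j + 1)) else 0)"
  have neg: "ip d (u i) (u i') < 0" if "i < i'" "i' \<le> d" for i i'
  proof -
    have "ip d (u i) (u i') = (\<Sum>j\<in>{i' - 1..<d}. u i j * u i' j)"
      unfolding ip_def by (intro sum.mono_neutral_right) (use that in \<open>auto simp: u_def\<close>)
    also have "{i' - 1..<d} = insert (i' - 1) {i'..<d}" using that by auto
    also have "(\<Sum>j\<in>insert (i' - 1) {i'..<d}. u i j * u i' j)
        = u i (i' - 1) * u i' (i' - 1) + (\<Sum>j\<in>{i'..<d}. u i j * u i' j)"
      using that by (subst sum.insert) auto
    also have "u i (i' - 1) * u i' (i' - 1) = - (1 / real i')"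
      using that by (auto simp: u_def)
    also have "(\<Sum>j\<in>{i'..<d}. u i j * u i' j) = (\<Sum>j\<in>{i'..<d}. (1 / (real j + 1))\<^sup>2)"
      using that by (intro sum.cong) (auto simp: u_def power2_eq_square)
    finally show ?thesis using sum_inverse_squares_less[of i' d] that by simp
  qed
  have nz: "ip d (u i) (u i) > 0" if "i \<le> d" for i
  proof -
    \<comment> \<open>For \<open>i = 0\<close> truncated subtraction selects coordinate 0, with
      entry \<open>-1\<close>; otherwise the entry is 1.\<close>
    have "u i (i - 1) \<noteq> 0" "i - 1 < d" using assms that by (auto simp: u_def)
    then have "ip d (u i) (u i) \<noteq> 0" by (auto simp: ip_self_eq_0)
    then show ?thesis using ip_self_nonneg[of d "u i"] by linarith
  qed
  define w where "w = (\<lambda>i j. (1 / sqrt (ip d (u i) (u i))) * u i j)"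
  show thesis
  proof (rule that[of w])
    show "ip d (w i) (w i) = 1" if "i \<le> d" for i
      unfolding w_def ip_scale_left ip_scale_right using nz[OF that] by (simp add: field_simps)
    show "ip d (w i) (w i') < 0" if "i \<le> d" "i' \<le> d" "i \<noteq> i'" for i i'
    proof -
      have "ip d (u i) (u i') < 0"
        using that neg[of i i'] neg[of i' i] by (metis ip_commute linorder_neqE_nat)
      then show ?thesis
        unfolding w_def ip_scale_left ip_scale_right using nz that
        by (simp add: divide_simps)
    qed
  qed
qed

section \<open>Extremal placement and its tight edges\<close>

lemma tight_vector_coloring:
  fixes V :: "'a set" and E :: "'a \<Rightarrow> 'a \<Rightarrow> bool"
  assumes fg: "finite_graph V E" and edge: "\<exists>u v. E u v"
    and c: "proper_coloring V E (Suc d) c" and d: "d \<ge> 1"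
  obtains f m where "unit_on V d f" "m < 0" "\<And>u v. E u v \<Longrightarrow> ip d (f u) (f v) \<le> m"
    "\<exists>u v. E u v \<and> ip d (f u) (f v) = m"
    "\<And>u. \<exists>v. E u v \<and> ip d (f u) (f v) = m \<Longrightarrow>
      \<exists>A l. A \<subseteq> {v. E u v \<and> ip d (f u) (f v) = m} \<and> card A \<le> d \<and> (\<forall>v\<in>A. l v \<ge> 0) \<and>
        (\<forall>j<d. - f u j = (\<Sum>v\<in>A. l v * f v j))"
proof -
  have sym: "E u v \<Longrightarrow> E v u" and inV: "E u v \<Longrightarrow> u \<in> V \<and> v \<in> V" and finV: "finite V" for u v
    using fg by (auto simp: finite_graph_def)
  have irr: "\<not> E u u" for u using c by (auto simp: proper_coloring_def)
  define D where "D = {(u, v). E u v}"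
  have D: "D \<subseteq> V \<times> V" "D \<noteq> {}" using inV edge by (auto simp: D_def)
  then have finD: "finite D" using finV by (meson finite_SigmaI finite_subset)
  obtain w where w: "\<And>i. i \<le> d \<Longrightarrow> ip d (w i) (w i) = 1"
    "\<And>i i'. i \<le> d \<Longrightarrow> i' \<le> d \<Longrightarrow> i \<noteq> i' \<Longrightarrow> ip d (w i) (w i') < 0"
    using negative_simplex[OF d] by blast
  define f0 where "f0 = (\<lambda>v. w (c v))"
  have cle: "c v \<le> d" if "v \<in> V" for v using c that by (auto simp: proper_coloring_def)
  have f0: "unit_on V d f0" using w cle by (auto simp: unit_on_def f0_def)
  obtain f1 m where f1: "unit_on V d f1" "\<And>u v. (u, v) \<in> D \<Longrightarrow> ip d (f1 u) (f1 v) \<le> m"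
    and opt: "\<And>g. unit_on V d g \<Longrightarrow> \<exists>(u, v) \<in> D. ip d (g u) (g v) \<ge> m"
    using optimal_vector_coloring[OF finD D(2) D(1) f0] by blast
  obtain u0 v0 where "E u0 v0" "ip d (f0 u0) (f0 v0) \<ge> m"
    using opt[OF f0] by (auto simp: D_def)
  then have m: "m < 0"
    using w(2)[of "c u0" "c v0"] cle inV c by (fastforce simp: f0_def proper_coloring_def)
  \<comment> \<open>As \<open>m\<close> is the optimal value, every good placement still has a tight
    edge; only the number of tight edges is left to minimise.\<close>
  define good where "good = (\<lambda>g. unit_on V d g \<and> (\<forall>u v. E u v \<longrightarrow> ip d (g u) (g v) \<le> m))"
  define T where "T = (\<lambda>g :: 'a \<Rightarrow> nat \<Rightarrow> real. {(u, v). E u v \<and> ip d (g u) (g v) = m})"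
  have "good f1" using f1 by (auto simp: good_def D_def)
  then obtain f where f: "good f" and min: "\<And>g. good g \<Longrightarrow> card (T f) \<le> card (T g)"
    using ex_has_least_nat[of good f1 "\<lambda>g. card (T g)"] by blast
  have finT: "finite (T g)" for g
    by (rule finite_subset[OF _ finD]) (auto simp: T_def D_def)
  show thesis
  proof (rule that[of f m])
    show "unit_on V d f" "m < 0" "\<And>u v. E u v \<Longrightarrow> ip d (f u) (f v) \<le> m"
      using f m by (auto simp: good_def)
    show "\<exists>u v. E u v \<and> ip d (f u) (f v) = m"
      using opt[of f] f by (force simp: good_def D_def)
    fix u assume "\<exists>v. E u v \<and> ip d (f u) (f v) = m"
    then obtain v where v: "E u v" "ip d (f u) (f v) = m" by blast
    let ?P = "{v. E u v \<and> ip d (f u) (f v) = m}"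
    have finP: "finite {v. E u v}" by (rule finite_subset[OF _ finV]) (use inV in auto)
    then have finP': "finite ?P" by simp
    have cone: "ip d (\<lambda>j. - 1 * f u j) x \<ge> 0" if x: "\<forall>v\<in>?P. ip d (f v) x \<ge> 0" for x
    proof (rule ccontr)
      assume "\<not> ?thesis"
      then have xu: "ip d x (f u) > 0" unfolding ip_scale_left by (simp add: ip_commute)
      have "\<exists>y. ip d y y = 1 \<and> (\<forall>v\<in>{v. E u v}. ip d y (f v) < m)"
        using f inV v x
        by (intro unit_perturbation[OF finP _ m xu])
          (auto simp: good_def unit_on_def ip_commute[of d x])
      then obtain y where y: "ip d y y = 1" "\<And>v. E u v \<Longrightarrow> ip d y (f v) < m" by blast
      define g where "g = f(u := y)"
      \<comment> \<open>Without loops, the other end of an edge at \<open>u\<close> has not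
        moved.\<close>
      have lt: "ip d (g a) (g b) < m" if "E a b" "a = u \<or> b = u" for a b
        using that(2)
      proof
        assume "a = u"
        then show ?thesis using that(1) y(2)[of b] irr by (auto simp: g_def)
      next
        assume "b = u"
        then show ?thesis using that(1) y(2)[of a] irr sym ip_commute[of d "f a" y]
          by (auto simp: g_def)
      qed
      have eq: "ip d (g a) (g b) = ip d (f a) (f b)" if "a \<noteq> u" "b \<noteq> u" for a b
        using that by (simp add: g_def)
      have "unit_on V d g" using f y by (auto simp: good_def unit_on_def g_def)
      moreover have "ip d (g a) (g b) \<le> m" if "E a b" for a b
        using f lt[OF that] eq[of a b] that by (force simp: good_def)
      ultimately have "good g" by (simp add: good_def)
      \<comment> \<open>Edges at \<open>u\<close> are now loose and all others unchanged, so at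
        least \<open>(u, v)\<close> is lost.\<close>
      have "T g \<subseteq> T f"
      proof clarify
        fix a b assume ab: "(a, b) \<in> T g"
        then have "a \<noteq> u \<and> b \<noteq> u" using lt[of a b] by (auto simp: T_def)
        then show "(a, b) \<in> T f" using ab eq[of a b] by (auto simp: T_def)
      qed
      moreover have "(u, v) \<in> T f - T g" using v lt[of u v] by (auto simp: T_def)
      ultimately have "card (T g) < card (T f)" by (intro psubset_card_mono finT) auto
      then show False using min[OF \<open>good g\<close>] by simp
    qed
    obtain l where "\<forall>v\<in>?P. l v \<ge> 0" "\<forall>j<d. - 1 * f u j = (\<Sum>v\<in>?P. l v * f v j)"
      using farkas[OF finP', of d f "\<lambda>j. - 1 * f u j"] cone by blast
    from cone_caratheodory[OF finP' this]
    show "\<exists>A l. A \<subseteq> ?P \<and> card A \<le> d \<and> (\<forall>v\<in>A. l v \<ge> 0) \<and> (\<forall>j<d. - f u j = (\<Sum>v\<in>A. l v * f v j))"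
      by auto
  qed
qed

section \<open>Propagation of disagreement down the tree\<close>

text \<open>A site has \<open>r + 1\<close> possible letters but only \<open>r\<close> are available for a child, namely those
  different from its last letter \<open>l\<close>; \<open>child_index l\<close> numbers them by \<open>0, \<dots>, r - 1\<close>. At the
  root the convention \<open>l = r\<close> makes the letters \<open>r - 1\<close> and \<open>r\<close> share a number.\<close>
definition child_index :: "nat \<Rightarrow> nat \<Rightarrow> nat" where
  "child_index l a = (if a < l then a else a - 1)"

text \<open>The word is a reversed site, so that \<open>a # w\<close> is a child of \<open>w\<close>
  and list recursion climbs to the root.\<close>

fun spread :: "nat \<Rightarrow> ('a \<Rightarrow> nat \<Rightarrow> 'a) \<Rightarrow> 'a \<Rightarrow> nat list \<Rightarrow> 'a" where
  "spread r g s [] = s"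
| "spread r g s (a # w) = g (spread r g s w) (child_index (if w = [] then r else hd w) a)"

text \<open>Let \<phi> grow from \<open>s\<close> by the rule \<open>g\<close>. Then
  \<open>step\<close> hands \<open>R\<close> between the values of \<phi> and \<psi> on to some
  child, whatever \<psi> does there; so \<open>R\<close> occurs at every level, while agreement at
  level \<open>n\<close> would contradict \<open>irrefl\<close>.\<close>

lemma long_range_actionI:
  assumes fg: "finite_graph V E" and r: "r \<ge> 1"
    and W: "W \<subseteq> V" and s: "s \<in> W" and i: "i \<in> V" "R s i"
    and g: "\<And>u j. u \<in> W \<Longrightarrow> j < r \<Longrightarrow> g u j \<in> W \<and> E u (g u j)"
    and irrefl: "\<And>u. u \<in> W \<Longrightarrow> \<not> R u u"
    and step: "\<And>u b. u \<in> W \<Longrightarrow> b \<in> V \<Longrightarrow> R u b \<Longrightarrow> \<exists>j<r. \<forall>b'. E b b' \<longrightarrow> R (g u j) b'"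
  shows "long_range_action r V E"
proof -
  define \<phi> where "\<phi> = (\<lambda>w. spread r g s (rev w))"
  define l where "l = (\<lambda>w :: nat list. if w = [] then r else last w)"
  have \<phi>_Nil: "\<phi> [] = s" by (simp add: \<phi>_def)
  have \<phi>_snoc: "\<phi> (w @ [a]) = g (\<phi> w) (child_index (l w) a)" for w a
    by (simp add: \<phi>_def l_def hd_rev)
  have sites_snoc: "w @ [a] \<in> tree_sites r \<longleftrightarrow> w \<in> tree_sites r \<and> a \<le> r \<and> (w = [] \<or> a \<noteq> last w)"
    for w a by (auto simp: tree_sites_def distinct_adj_append_iff)
  have l_le: "l w \<le> r" if "w \<in> tree_sites r" for w
    using that last_in_set[of w] by (force simp: l_def tree_sites_def)
  \<comment> \<open>Only at the root can \<open>a\<close> equal \<open>l w\<close>, both being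
    \<open>r\<close>; the index is then \<open>r - 1\<close>, which needs
    \<open>r \<ge> 1\<close>.\<close>
  have idx: "child_index (l w) a < r" if "w @ [a] \<in> tree_sites r" for w a
    using that r l_le[of w] by (auto simp: sites_snoc child_index_def l_def)
  have \<phi>_W: "\<phi> w \<in> W" if "w \<in> tree_sites r" for w
    using that
  proof (induction w rule: rev_induct)
    case Nil
    then show ?case by (simp add: \<phi>_Nil s)
  next
    case (snoc a w)
    then show ?case using g idx by (auto simp: \<phi>_snoc sites_snoc)
  qed
  have \<phi>_E: "E (\<phi> w) (\<phi> (w @ [a]))" if "w @ [a] \<in> tree_sites r" for w a
    using that g \<phi>_W idx by (auto simp: \<phi>_snoc sites_snoc)
  have sym: "E u v \<Longrightarrow> E v u" for u v using fg by (auto simp: finite_graph_def)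
  have "\<phi> \<in> tree_hom r V E"
    using \<phi>_W W \<phi>_E sym by (auto simp: tree_hom_def tree_adj_def)
  moreover have "\<not> (\<exists>\<psi>\<in>tree_hom r V E.
      (\<forall>w\<in>tree_sites r. length w = n \<longrightarrow> \<psi> w = \<phi> w) \<and> \<psi> tree_root = i)" for n
  proof clarify
    fix \<psi> assume \<psi>: "\<psi> \<in> tree_hom r V E" "\<forall>w\<in>tree_sites r. length w = n \<longrightarrow> \<psi> w = \<phi> w"
      and root: "i = \<psi> tree_root"
    have "\<exists>w\<in>tree_sites r. length w = k \<and> R (\<phi> w) (\<psi> w)" for k
    proof (induction k)
      case 0
      show ?case using i root
        by (auto simp: tree_sites_def \<phi>_Nil tree_root_def intro!: bexI[of _ "[]"])
    next
      case (Suc k)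
      then obtain w where w: "w \<in> tree_sites r" "length w = k" "R (\<phi> w) (\<psi> w)" by blast
      have "\<psi> w \<in> V" using \<psi>(1) w(1) by (auto simp: tree_hom_def)
      then obtain j where j: "j < r" "\<And>b'. E (\<psi> w) b' \<Longrightarrow> R (g (\<phi> w) j) b'"
        using step[OF \<phi>_W[OF w(1)] _ w(3)] by blast
      \<comment> \<open>Inverse of the numbering: skip the last letter of \<open>w\<close>. At the
        root this gives \<open>a = j\<close>.\<close>
      define a where "a = (if j < l w then j else Suc j)"
      have child: "w @ [a] \<in> tree_sites r" "child_index (l w) a = j"
        using w(1) j(1) by (auto simp: sites_snoc a_def child_index_def l_def)
      have "E (\<psi> w) (\<psi> (w @ [a]))"
        using \<psi>(1) child(1) w(1) by (auto simp: tree_hom_def tree_adj_def)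
      then have "R (\<phi> (w @ [a])) (\<psi> (w @ [a]))"
        using j(2) child(2) by (simp add: \<phi>_snoc)
      then show ?case using child(1) w(2) by (intro bexI[of _ "w @ [a]"]) auto
    qed
    then obtain w where "w \<in> tree_sites r" "length w = n" "R (\<phi> w) (\<psi> w)" by blast
    then show False using irrefl[OF \<phi>_W] \<psi>(2) by force
  qed
  ultimately show ?thesis using i(1) unfolding long_range_action_def by blast
qed

section \<open>Long range action from the extremal placement\<close>

theorem theorem10p1:
  fixes k :: nat and V :: "'a set" and E :: "'a \<Rightarrow> 'a \<Rightarrow> bool"
  assumes "k \<ge> 2"
    and "finite_graph V E"
    and "\<exists>u v. E u v"
    and "\<exists>c. proper_coloring V E k c"
  shows "long_range_action (k - 1) V E"
proof -
  \<comment> \<open>Both the dimension in which a simplex has \<open>k\<close> vertices and the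
    number of child indices, matching the Caratheodory bound.\<close>
  define d where "d = k - 1"
  have d: "d \<ge> 1" "Suc d = k" using assms(1) by (auto simp: d_def)
  have sym: "E u v \<Longrightarrow> E v u" and inV: "E u v \<Longrightarrow> u \<in> V \<and> v \<in> V" for u v
    using assms(2) by (auto simp: finite_graph_def)
  obtain c where c: "proper_coloring V E (Suc d) c"
    using assms(4) d(2) by blast
  obtain f m where unit: "unit_on V d f" and m: "m < 0"
    and le: "\<And>u v. E u v \<Longrightarrow> ip d (f u) (f v) \<le> m"
    and ex: "\<exists>u v. E u v \<and> ip d (f u) (f v) = m"
    and cone: "\<And>u. \<exists>v. E u v \<and> ip d (f u) (f v) = m \<Longrightarrow>
      \<exists>A l. A \<subseteq> {v. E u v \<and> ip d (f u) (f v) = m} \<and> card A \<le> d \<and> (\<forall>v\<in>A. l v \<ge> 0) \<and>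
        (\<forall>j<d. - f u j = (\<Sum>v\<in>A. l v * f v j))"
    using tight_vector_coloring[OF assms(2,3) c d(1)] by blast
  define P where "P = (\<lambda>u. {v. E u v \<and> ip d (f u) (f v) = m})"
  define W where "W = {u. P u \<noteq> {}}"
  \<comment> \<open>For unit vectors this says that \<open>f a\<close> and \<open>f b\<close>
    differ, which is stronger than \<open>a \<noteq> b\<close> since nodes may share a
    vector.\<close>
  define R where "R = (\<lambda>a b. ip d (f a) (f b) < 1)"
  have WV: "W \<subseteq> V" using inV by (auto simp: W_def P_def)
  have PW: "v \<in> W" if "v \<in> P u" for u v
    using that sym by (auto simp: W_def P_def ip_commute)
  have unitV: "ip d (f v) (f v) = 1" if "v \<in> V" for v
    using unit that by (simp add: unit_on_def)
  have "\<exists>h. (\<forall>j<d. h j \<in> P u) \<and>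
      (\<forall>b\<in>V. R u b \<longrightarrow> (\<exists>j<d. ip d (f (h j)) (f b) > m))" if u: "u \<in> W" for u
  proof -
    obtain A l where A: "A \<subseteq> P u" "card A \<le> d" "\<forall>v\<in>A. l v \<ge> 0"
      "\<forall>j<d. - f u j = (\<Sum>v\<in>A. l v * f v j)"
      using cone[of u] u by (auto simp: W_def P_def)
    have "P u \<subseteq> V" using inV by (auto simp: P_def)
    then have finA: "finite A"
      using A(1) assms(2) by (meson finite_graph_def finite_subset)
    have expand: "- ip d (f u) y = (\<Sum>v\<in>A. l v * ip d (f v) y)" for y
    proof -
      have "- ip d (f u) y = ip d (\<lambda>j. - 1 * f u j) y" unfolding ip_scale_left by simp
      also have "\<dots> = ip d (\<lambda>j. \<Sum>v\<in>A. l v * f v j) y" using A(4) by (intro ip_cong) auto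
      finally show ?thesis by (simp add: ip_sum_left)
    qed
    have "1 = ip d (f u) (f u)" using u WV unitV by auto
    then have "- 1 = (\<Sum>v\<in>A. l v * ip d (f v) (f u))"
      using expand[of "f u"] by simp
    also have "\<dots> = (\<Sum>v\<in>A. l v * m)"
      using A(1) by (intro sum.cong) (auto simp: P_def ip_commute)
    finally have total: "(\<Sum>v\<in>A. l v * m) = - 1" by simp
    \<comment> \<open>Otherwise the expansion of \<open>- ip d (f u) (f b)\<close> is at most
      \<open>total\<close>, that is \<open>-1\<close>, which forces inner product at least
      1.\<close>
    have escape: "\<exists>v\<in>A. ip d (f v) (f b) > m" if "R u b" for b
    proof (rule ccontr)
      assume "\<not> ?thesis"
      then have "(\<Sum>v\<in>A. l v * ip d (f v) (f b)) \<le> (\<Sum>v\<in>A. l v * m)"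
        using A(3) by (intro sum_mono mult_left_mono) (auto simp: not_less)
      then show False using that total expand[of "f b"] by (simp add: R_def)
    qed
    \<comment> \<open>Pads the enumeration of \<open>A\<close> to length \<open>d\<close>, so that
      every child receives a tight neighbour.\<close>
    obtain v0 where v0: "v0 \<in> P u" using u by (auto simp: W_def)
    obtain h where h: "bij_betw h {0..<card A} A"
      using ex_bij_betw_nat_finite[OF finA] by blast
    define h' where "h' = (\<lambda>j. if j < card A then h j else v0)"
    have "h' j \<in> P u" for j
      using h v0 A(1) by (auto simp: h'_def dest!: bij_betwE)
    moreover have "\<exists>j<d. h' j = v" if "v \<in> A" for v
    proof -
      obtain j where "j < card A" "h j = v"
        using h \<open>v \<in> A\<close> by (metis atLeast0LessThan bij_betw_iff_bijections lessThan_iff)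
      then show ?thesis using A(2) by (intro exI[of _ j]) (auto simp: h'_def)
    qed
    ultimately show ?thesis using escape by metis
  qed
  then have "\<forall>u\<in>W. \<exists>h. (\<forall>j<d. h j \<in> P u) \<and>
      (\<forall>b\<in>V. R u b \<longrightarrow> (\<exists>j<d. ip d (f (h j)) (f b) > m))" by blast
  then obtain g where "\<forall>u\<in>W. (\<forall>j<d. g u j \<in> P u) \<and>
      (\<forall>b\<in>V. R u b \<longrightarrow> (\<exists>j<d. ip d (f (g u j)) (f b) > m))"
    unfolding bchoice_iff by blast
  then have gP: "\<And>u j. u \<in> W \<Longrightarrow> j < d \<Longrightarrow> g u j \<in> P u"
    and gesc: "\<And>u b. u \<in> W \<Longrightarrow> b \<in> V \<Longrightarrow> R u b \<Longrightarrow> \<exists>j<d. ip d (f (g u j)) (f b) > m"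
    by blast+
  \<comment> \<open>A tight edge serves twice: its end \<open>s\<close> starts \<phi>, and
    \<open>i\<close> is the root value to be excluded, as \<open>m < 0\<close> gives
    \<open>R s i\<close>.\<close>
  obtain s i where si: "E s i" "ip d (f s) (f i) = m" using ex by blast
  have "long_range_action d V E"
  proof (rule long_range_actionI[where W = W and s = s and i = i and R = R and g = g])
    show "finite_graph V E" "d \<ge> 1" "W \<subseteq> V" "s \<in> W" "i \<in> V" "R s i"
      using assms d WV si inV m by (auto simp: W_def P_def R_def)
    show "g u j \<in> W \<and> E u (g u j)" if "u \<in> W" "j < d" for u j
      using gP[OF that] PW by (auto simp: P_def)
    show "\<not> R u u" if "u \<in> W" for u
      using unitV[of u] that WV by (auto simp: R_def)
    show "\<exists>j<d. \<forall>b'. E b b' \<longrightarrow> R (g u j) b'" if ub: "u \<in> W" "b \<in> V" "R u b" for u b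
    proof -
      obtain j where j: "j < d" "ip d (f (g u j)) (f b) > m" using gesc[OF ub] by blast
      have gV: "g u j \<in> V" using gP[OF ub(1) j(1)] PW WV by blast
      have "R (g u j) b'" if "E b b'" for b'
      proof (rule ccontr)
        assume "\<not> ?thesis"
        \<comment> \<open>Inner product 1 makes the two unit vectors coincide, so the edge bound for
          \<open>b'\<close> and \<open>b\<close> contradicts the choice of \<open>j\<close>.\<close>
        then have 1: "ip d (f (g u j)) (f b') = 1"
          using ip_unit_le_1[OF unitV unitV] gV inV[OF that] by (force simp: R_def)
        have "ip d (f (g u j)) (f b) = ip d (f b') (f b)"
          using ip_unit_eq_1D[OF unitV unitV 1] gV inV[OF that] by (intro ip_cong) auto
        then show False using j(2) le[OF sym[OF that]] by simp
      qed
      then show ?thesis using j(1) by blast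
    qed
  qed
  then show ?thesis by (simp add: d_def)
qed

end
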